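(* Assume (PD) has a solution. Let $$\psi_d=\inf_{(y^*,s^* )\in\Omega^D}\ \min_{i\in\mathcal{A}_+(s^* )}s^*_i$$ and assume $0<\psi_d<\infty$. Fix $\lambda\in\mathbb{R}^n$, $\lambda\ge0$, and $C$ such that $$0<\|\lambda\|<\min\left(1,\frac{\psi_d}{16\max(\tau_p,\tau_d)}\right)\quad\text{and}\quad C=\frac{\psi_d}{2}.$$ Let $(x,y,s)\in\mathcal{F}^0_\lambda$ with $\mu_\lambda=\frac{(x+\lambda)^T(s+\lambda)}{n}$ sufficiently small, namely $$\mu_\lambda<\frac{\psi_d}{4C_2\max(\tau_p,\tau_d)}.$$ Then there exists a solution $(x^*,y^*,s^* )$ of (PD) such that $\bar{\mathcal{A}}_+(s)=\mathcal{A}_+(s^* )$.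
   Context: Vector inequalities are componentwise; $\|\cdot\|$ is the Euclidean norm; $A\in\mathbb{R}^{m\times n}$ ($m\le n$), $b\in\mathbb{R}^m$, $c\in\mathbb{R}^n$. A minimum over an empty index set is $+\infty$. (PD): minimize $c^Tx$ s.t. $Ax=b$, $x\ge 0$; and its dual, maximize $b^Ty$ s.t. $A^Ty+s=c$, $s\ge0$. $\Omega^D$ is the solution set of the dual problem. A solution of (PD) is a triple $(x^*,y^*,s^* )$ with $x^*$ primal optimal and $(y^*,s^* )$ dual optimal. For $\lambda\ge0$, (PD$_\lambda$): minimize $(c+\lambda)^T(x+\lambda)$ s.t. $Ax=b$, $x\ge-\lambda$; and its dual, maximize $(b+A\lambda)^Ty$ s.t. $A^Ty+s=c$, $s\ge-\lambda$. Its set of strictly feasible points is $\mathcal{F}^0_\lambda=\{(x,y,s): Ax=b,\ A^Ty+s=c,\ x+\lambda>0,\ s+\lambda>0\}$. Let $\Omega^P_\lambda$ and $\Omega^D_\lambda$ be the primal and dual solution sets of (PD$_\lambda$), and let $(\mathcal{A}_\lambda,\mathcal{I}_\lambda)$ be the strictly complementary partition of $\{1,\dots,n\}$: $\mathcal{I}_\lambda=\{i: x_i+\lambda_i>0 \text{ for some } x\in\Omega^P_\lambda\}$, $\mathcal{A}_\lambda=\{i: s_i+\lambda_i>0\text{ for some }(y,s)\in\Omega^D_\lambda\}$. With $b_\lambda=b+A\lambda$, $c_\lambda=c+\lambda$, define $$\epsilon(A,b_\lambda,c_\lambda)=\min\Big(\min_{i\in\mathcal{I}_\lambda}\sup_{x\in\Omega^P_\lambda}(x_i+\lambda_i),\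 \min_{i\in\mathcal{A}_\lambda}\sup_{(y,s)\in\Omega^D_\lambda}(s_i+\lambda_i)\Big)>0,\qquad C_2=\frac{n\sqrt n}{\epsilon(A,b_\lambda,c_\lambda)}+n .$$ $\tau_p,\tau_d>0$ are fixed constants depending only on $(A,b,c)$ with the property (such constants exist) that for every $\lambda\ge0$ and every $(x,y,s)\in\mathcal{F}^0_\lambda$ there is a solution $(x^*,y^*,s^* )$ of (PD) with $$\|x-x^*\|<\tau_p\big(C_2\mu_\lambda+4\|\lambda\|\max(\|\lambda\|,1)\big),\qquad \|s-s^*\|<\tau_d\big(C_2\mu_\lambda+4\|\lambda\|\max(\|\lambda\|,1)\big),$$ where $\mu_\lambda=(x+\lambda)^T(s+\lambda)/n$. $\mathcal{A}_+(s^* )=\{i\in\{1,\dots,n\}:s^*_i>0\}$; the predicted strictly active set with threshold $C$ is $\bar{\mathcal{A}}_+(s)=\{i\in\{1,\dots,n\}:s_i\ge C\}$. *)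

theory Defs
  imports "HOL-Analysis.Analysis"
begin

text \<open>On \<open>real ^ 'n\<close> the relation \<open>\<le>\<close> is componentwise, but \<open>x < y\<close> unfolds to
  \<open>x \<le> y \<and> \<not> y \<le> x\<close>; strict vector inequalities are therefore written componentwise.\<close>

definition primal_solutions ::
    "real ^ 'n ^ 'm \<Rightarrow> real ^ 'm \<Rightarrow> real ^ 'n \<Rightarrow> (real ^ 'n) set" where
  "primal_solutions A b c =
     {x. is_arg_min (\<lambda>x. c \<bullet> x) (\<lambda>x. A *v x = b \<and> 0 \<le> x) x}"

definition dual_solutions ::
    "real ^ 'n ^ 'm \<Rightarrow> real ^ 'm \<Rightarrow> real ^ 'n \<Rightarrow> ((real ^ 'm) \<times> (real ^ 'n)) set" where
  "dual_solutions A b c =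
     {(y, s). is_arg_max (\<lambda>(y, s). b \<bullet> y) (\<lambda>(y, s). transpose A *v y + s = c \<and> 0 \<le> s) (y, s)}"

definition is_solution ::
    "real ^ 'n ^ 'm \<Rightarrow> real ^ 'm \<Rightarrow> real ^ 'n \<Rightarrow>
     real ^ 'n \<Rightarrow> real ^ 'm \<Rightarrow> real ^ 'n \<Rightarrow> bool" where
  "is_solution A b c x y s \<longleftrightarrow> x \<in> primal_solutions A b c \<and> (y, s) \<in> dual_solutions A b c"

definition pert_primal_solutions ::
    "real ^ 'n ^ 'm \<Rightarrow> real ^ 'm \<Rightarrow> real ^ 'n \<Rightarrow> real ^ 'n \<Rightarrow> (real ^ 'n) set" where
  "pert_primal_solutions A b c l =
     {x. is_arg_min (\<lambda>x. (c + l) \<bullet> (x + l)) (\<lambda>x. A *v x = b \<and> - l \<le> x) x}"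

definition pert_dual_solutions ::
    "real ^ 'n ^ 'm \<Rightarrow> real ^ 'm \<Rightarrow> real ^ 'n \<Rightarrow> real ^ 'n \<Rightarrow> ((real ^ 'm) \<times> (real ^ 'n)) set" where
  "pert_dual_solutions A b c l =
     {(y, s). is_arg_max (\<lambda>(y, s). (b + A *v l) \<bullet> y)
                (\<lambda>(y, s). transpose A *v y + s = c \<and> - l \<le> s) (y, s)}"

definition strictly_feasible ::
    "real ^ 'n ^ 'm \<Rightarrow> real ^ 'm \<Rightarrow> real ^ 'n \<Rightarrow> real ^ 'n \<Rightarrow>
     ((real ^ 'n) \<times> (real ^ 'm) \<times> (real ^ 'n)) set" where
  "strictly_feasible A b c l =
     {(x, y, s). A *v x = b \<and> transpose A *v y + s = c \<and>
        (\<forall>i. 0 < (x + l) $ i) \<and> (\<forall>i. 0 < (s + l) $ i)}"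

definition inactive_part ::
    "real ^ 'n ^ 'm \<Rightarrow> real ^ 'm \<Rightarrow> real ^ 'n \<Rightarrow> real ^ 'n \<Rightarrow> 'n set" where
  "inactive_part A b c l = {i. \<exists>x \<in> pert_primal_solutions A b c l. 0 < x $ i + l $ i}"

definition active_part ::
    "real ^ 'n ^ 'm \<Rightarrow> real ^ 'm \<Rightarrow> real ^ 'n \<Rightarrow> real ^ 'n \<Rightarrow> 'n set" where
  "active_part A b c l = {i. \<exists>(y, s) \<in> pert_dual_solutions A b c l. 0 < s $ i + l $ i}"

text \<open>Minima over finite index sets are taken as infima in \<open>ereal\<close>, so that the minimum
  over the empty set is \<open>\<infinity>\<close>.\<close>

definition eps ::
    "real ^ 'n ^ 'm \<Rightarrow> real ^ 'm \<Rightarrow> real ^ 'n \<Rightarrow> real ^ 'n \<Rightarrow> ereal" where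
  "eps A b c l =
     min (INF i \<in> inactive_part A b c l.
            SUP x \<in> pert_primal_solutions A b c l. ereal (x $ i + l $ i))
         (INF i \<in> active_part A b c l.
            SUP (y, s) \<in> pert_dual_solutions A b c l. ereal (s $ i + l $ i))"

text \<open>\<open>eps\<close> is a positive real whenever \<open>strictly_feasible A b c l\<close> is nonempty, the only
  case in which \<open>C2\<close> is used. (If \<open>eps = \<infinity>\<close>, the quotient below is \<open>0\<close>.)\<close>

definition C2 ::
    "real ^ 'n ^ 'm \<Rightarrow> real ^ 'm \<Rightarrow> real ^ 'n \<Rightarrow> real ^ 'n \<Rightarrow> real" where
  "C2 A b c l =
     real CARD('n) * sqrt (real CARD('n)) / real_of_ereal (eps A b c l) + real CARD('n)"

definition mu :: "real ^ 'n \<Rightarrow> real ^ 'n \<Rightarrow> real ^ 'n \<Rightarrow> real" where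
  "mu l x s = ((x + l) \<bullet> (s + l)) / real CARD('n)"

definition error_bound_constants ::
    "real ^ 'n ^ 'm \<Rightarrow> real ^ 'm \<Rightarrow> real ^ 'n \<Rightarrow> real \<Rightarrow> real \<Rightarrow> bool" where
  "error_bound_constants A b c \<tau>p \<tau>d \<longleftrightarrow>
     0 < \<tau>p \<and> 0 < \<tau>d \<and>
     (\<forall>l x y s. 0 \<le> l \<longrightarrow> (x, y, s) \<in> strictly_feasible A b c l \<longrightarrow>
        (\<exists>x' y' s'. is_solution A b c x' y' s' \<and>
           norm (x - x') < \<tau>p * (C2 A b c l * mu l x s + 4 * norm l * max (norm l) 1) \<and>
           norm (s - s') < \<tau>d * (C2 A b c l * mu l x s + 4 * norm l * max (norm l) 1)))"

definition strictly_active :: "real ^ 'n \<Rightarrow> 'n set" where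
  "strictly_active s = {i. 0 < s $ i}"

definition predicted_strictly_active :: "real \<Rightarrow> real ^ 'n \<Rightarrow> 'n set" where
  "predicted_strictly_active C s = {i. C \<le> s $ i}"

definition psi_d :: "real ^ 'n ^ 'm \<Rightarrow> real ^ 'm \<Rightarrow> real ^ 'n \<Rightarrow> ereal" where
  "psi_d A b c =
     (INF (y, s) \<in> dual_solutions A b c. INF i \<in> strictly_active s. ereal (s $ i))"

end

theory Submission
  imports Defs
begin

text \<open>Strictly positive entries of a dual optimal slack \<open>s'\<close> are separated from its zero entries by
  a gap of width \<open>\<psi>\<close>, the value of \<^term>\<open>psi_d A b c\<close> (psi_d_le). The threshold \<open>C = \<psi> / 2\<close> lies
  in the middle of this gap, so it recovers the positive entries of \<open>s'\<close> from any \<open>s\<close> whose distance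
  to \<open>s'\<close> is less than \<open>\<psi> / 2\<close> (thresholding). The error bound provides such an \<open>s'\<close>: since
  \<open>\<parallel>\<lambda>\<parallel> < 1\<close>, the distance is less than
  \<open>max \<tau>\<^sub>p \<tau>\<^sub>d * (C\<^sub>2 \<mu> + 4 \<parallel>\<lambda>\<parallel>)\<close>, and the bounds on \<open>\<mu>\<close> and \<open>\<parallel>\<lambda>\<parallel>\<close> make each of the two
  terms less than \<open>\<psi> / 4\<close> (error_radius). Multiplying out the bound on \<open>\<mu>\<close> relies on
  \<open>C\<^sub>2 > 0\<close> (C2_pos).\<close>

text \<open>Every index in one of the two parts has a witness among the solutions, so each of the suprema
  in \<^const>\<open>eps\<close> is positive; an infimum over an empty part is \<open>\<infinity>\<close>.\<close>

lemma eps_nonneg: "0 \<le> eps A b c l"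
proof -
  have "0 \<le> (SUP x \<in> pert_primal_solutions A b c l. ereal (x $ i + l $ i))"
    if "i \<in> inactive_part A b c l" for i
  proof -
    from that obtain x where "x \<in> pert_primal_solutions A b c l" "0 < x $ i + l $ i"
      by (auto simp: inactive_part_def)
    then show ?thesis
      by (intro SUP_upper2[of x]) auto
  qed
  moreover have "0 \<le> (SUP (y, s) \<in> pert_dual_solutions A b c l. ereal (s $ i + l $ i))"
    if "i \<in> active_part A b c l" for i
  proof -
    from that obtain y s where "(y, s) \<in> pert_dual_solutions A b c l" "0 < s $ i + l $ i"
      by (auto simp: active_part_def)
    then show ?thesis
      by (intro SUP_upper2[of "(y, s)"]) auto
  qed
  ultimately show ?thesis
    unfolding eps_def by (intro min.boundedI INF_greatest)
qed

lemma C2_pos: "0 < C2 A b c l"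
  unfolding C2_def
  by (intro add_nonneg_pos divide_nonneg_nonneg) (auto intro: real_of_ereal_pos eps_nonneg)

lemma psi_d_le:
  assumes "(y, s) \<in> dual_solutions A b c" and "0 < s $ i"
  shows "psi_d A b c \<le> ereal (s $ i)"
proof -
  have "(INF j \<in> strictly_active s. ereal (s $ j)) \<le> ereal (s $ i)"
    using assms(2) by (intro INF_lower) (simp add: strictly_active_def)
  with assms(1) show ?thesis
    unfolding psi_d_def by (intro INF_lower2[of "(y, s)"]) auto
qed

text \<open>An entry of \<open>s\<close> differs from the same entry of \<open>s'\<close> by less than half the gap, so it stays above
  the threshold if it comes from an entry of at least \<open>\<psi>\<close>, and an entry that reaches the threshold
  cannot come from one that is \<open>0\<close> or negative.\<close>

lemma thresholding:
  fixes s s' :: "real ^ 'n"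
  assumes gap: "\<And>i. 0 < s' $ i \<Longrightarrow> \<psi> \<le> s' $ i"
    and close: "norm (s - s') < \<psi> / 2"
  shows "predicted_strictly_active (\<psi> / 2) s = strictly_active s'"
proof -
  have "\<psi> / 2 \<le> s $ i \<longleftrightarrow> 0 < s' $ i" for i
  proof -
    have "\<bar>s $ i - s' $ i\<bar> < \<psi> / 2"
      using component_le_norm_cart[of "s - s'" i] close by simp
    with gap[of i] show ?thesis
      by linarith
  qed
  then show ?thesis
    by (simp add: predicted_strictly_active_def strictly_active_def)
qed

text \<open>The constants \<open>4\<close> and \<open>16\<close> split the radius \<open>\<psi> / 2\<close> evenly between the term in \<open>\<mu>\<close> and the
  term in the norm \<open>r\<close> of the perturbation, the latter carrying a factor \<open>4\<close> of its own.\<close>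

lemma error_radius:
  fixes K \<tau> \<psi> \<mu> r :: real
  assumes "0 < K" and "0 < \<tau>"
    and \<mu>: "\<mu> < \<psi> / (4 * K * \<tau>)" and r: "r < min 1 (\<psi> / (16 * \<tau>))"
  shows "\<tau> * (K * \<mu> + 4 * r * max r 1) < \<psi> / 2"
proof -
  have "\<tau> * K * \<mu> < \<psi> / 4"
    using \<mu> assms(1,2) by (simp add: field_simps)
  moreover have "\<tau> * (4 * r) < \<psi> / 4"
    using r assms(2) by (simp add: field_simps)
  moreover have "max r 1 = 1"
    using r by simp
  ultimately show ?thesis
    by (simp add: algebra_simps)
qed

theorem theorem6:
  fixes A :: "real ^ 'n ^ 'm" and b :: "real ^ 'm" and c :: "real ^ 'n"
    and \<tau>p \<tau>d C :: real
    and l x s :: "real ^ 'n" and y :: "real ^ 'm"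
  assumes "CARD('m) \<le> CARD('n)"
    and "error_bound_constants A b c \<tau>p \<tau>d"
    and "\<exists>x' y' s'. is_solution A b c x' y' s'"
    and "0 < psi_d A b c" and "psi_d A b c < \<infinity>"
    and "0 \<le> l"
    and "0 < norm l"
    and "norm l < min 1 (real_of_ereal (psi_d A b c) / (16 * max \<tau>p \<tau>d))"
    and "C = real_of_ereal (psi_d A b c) / 2"
    and "(x, y, s) \<in> strictly_feasible A b c l"
    and "mu l x s < real_of_ereal (psi_d A b c) / (4 * C2 A b c l * max \<tau>p \<tau>d)"
  shows "\<exists>x' y' s'. is_solution A b c x' y' s' \<and>
           predicted_strictly_active C s = strictly_active s'"
proof -
  define \<psi> where "\<psi> = real_of_ereal (psi_d A b c)"
  define Q where "Q = C2 A b c l * mu l x s + 4 * norm l * max (norm l) 1"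
  have psi: "psi_d A b c = ereal \<psi>"
    unfolding \<psi>_def using assms(4,5) by (cases "psi_d A b c") auto
  have \<tau>: "0 < \<tau>d"
    using assms(2) by (simp add: error_bound_constants_def)
  obtain x' y' s' where sol: "is_solution A b c x' y' s'" and dist: "norm (s - s') < \<tau>d * Q"
    using assms(2,6,10) unfolding error_bound_constants_def Q_def by blast
  have "0 < Q"
    using dist \<tau> norm_ge_zero[of "s - s'"] by (metis le_less_trans zero_less_mult_pos)
  then have "\<tau>d * Q \<le> max \<tau>p \<tau>d * Q"
    by (intro mult_right_mono) auto
  also have "max \<tau>p \<tau>d * Q < \<psi> / 2"
    unfolding Q_def
    by (rule error_radius) (use C2_pos \<tau> assms(8,11) in \<open>auto simp: \<psi>_def\<close>)
  finally have close: "norm (s - s') < \<psi> / 2"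
    using dist by simp
  have gap: "\<psi> \<le> s' $ i" if "0 < s' $ i" for i
    using psi_d_le[of y' s' A b c i] sol that by (simp add: is_solution_def psi)
  have "predicted_strictly_active C s = strictly_active s'"
    using thresholding[OF gap close] by (simp add: assms(9) \<psi>_def)
  with sol show ?thesis
    by blast
qed

end
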